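(* Let the sets $B(\bm{0},R)$ and $X_{\infty}$ satisfy: (a) $B(\bm{0},R)=\{\bm{x}\in\mathbb{R}^n\mid h_0(\bm{x})\le R\}$ with $h_0(\bm{x})=\sum_{i=1}^n x_i^2$ and $R>0$ a constant such that $\Omega(X)\subset B(\bm{0},R)$, where $\Omega(X)=\{\bm{x}\in\mathbb{R}^n\mid \bm{x}=\bm{f}(\bm{x}_0,\bm{d}),\ \bm{x}_0\in X,\ \bm{d}\in D\}\cup X$; (b) $X_{\infty}=\{\bm{x}\in\mathbb{R}^n\mid h_{\infty}(\bm{x})<1\}$, with $h_{\infty}\in\mathbb{R}[\bm{x}]$, is a robust region of attraction and $\bm{0}\in X_{\infty}^{\circ}$. If $u\in\mathbb{R}_k[\bm{x}]$ is a solution to the sum-of-squares program (SOS) given in the context, then $\{\bm{x}\in B(\bm{0},R)\mid u(\bm{x})<1\}$ is a robust region of attraction.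
   Context: $\mathbb{N}$ is the set of non-negative integers; $\mathbb{R}_k[\bm{x}]$ is the space of real polynomials in $\bm{x}$ of total degree $\le k$; $\Delta^\circ$ is the interior of $\Delta$. System: $\bm{x}(k+1)=\bm{f}(\bm{x}(k),\bm{d}(k))$, $k\in\mathbb{N}$, where $\bm{f}$ is an $\mathbb{R}^n$-valued map with components in $\mathbb{R}[\bm{x},\bm{d}]$ ($\bm{x}\in\mathbb{R}^n$, $\bm{d}\in\mathbb{R}^m$), $D=\{\bm{d}\in\mathbb{R}^m\mid h_i^D(\bm{d})\le 0,\ i=1,\ldots,m_d\}$ is compact with $h_i^D\in\mathbb{R}[\bm{d}]$, and $\bm{f}(\bm{0},\bm{d})=\bm{0}$ for all $\bm{d}\in D$. A perturbation input policy is a function $\pi:\mathbb{N}\to D$; $\mathcal{D}$ is the set of all of them. The trajectory from $\bm{x}_0$ under $\pi$ is $\bm{\phi}_{\bm{x}_0}^{\pi}(0)=\bm{x}_0$, $\bm{\phi}_{\bm{x}_0}^{\pi}(k+1)=\bm{f}(\bm{\phi}_{\bm{x}_0}^{\pi}(k),\pi(k))$. State constraint set: $X=\{\bm{x}\in\mathbb{R}^n\mid h_i^X(\bm{x})<1,\ i=1,\ldots,n_X\}$ is bounded and open, with $h_i^X\in\mathbb{R}[\bm{x}]$, $h_i^X(\bm{x})>0$ for $\bm{x}\ne\bm{0}$ and $h_i^X(\bm{0})=0$. Maximal robust region of attraction: $\mathcal{R}=\{\bm{x}_0\mid \bm{\phi}_{\bm{x}_0}^{\pi}(k)\in X\ \forall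 k\in\mathbb{N},\forall\pi\in\mathcal{D},\ \text{and}\ \lim_{k\to\infty}\bm{\phi}_{\bm{x}_0}^{\pi}(k)=\bm{0}\ \forall\pi\in\mathcal{D}\}$. A robust region of attraction is any subset of $\mathcal{R}$. $g\in\mathbb{R}[\bm{x}]$ is a fixed non-negative polynomial with $g(\bm{x})=0$ iff $\bm{x}=\bm{0}$. Program (SOS): minimize $\int_{B(\bm{0},R)}u\,d\bm{x}-\int_{X_\infty}u\,d\bm{x}$ over $u\in\mathbb{R}_k[\bm{x}]$ and sum-of-squares polynomials $s_0,s_1,s_2,s_{3,i}\in\mathbb{R}[\bm{x},\bm{d}]$ ($i=1,\ldots,m_d$) and $s_{4,j},\ldots,s_{8,j},s_{9,l,j}\in\mathbb{R}[\bm{x}]$ ($j,l=1,\ldots,n_X$), subject to the polynomial identities, for $j=1,\ldots,n_X$, $$u(\bm{x})-u(\bm{f}(\bm{x},\bm{d}))-g(\bm{x})(1-u(\bm{x}))=s_0+s_1(R-h_0)+s_2(h_\infty-1)-\sum_{i=1}^{m_d}s_{3,i}h_i^D,$$ $$u-1=s_{4,j}+s_{5,j}(R-h_0)+s_{6,j}(h_j^X-1),$$ $$u-h_j^X=s_{7,j}+s_{8,j}(R-h_0)+\sum_{l=1}^{n_X}s_{9,l,j}(1-h_l^X).$$ A polynomial $u$ is called a solution to (SOS) if there are sum-of-squares polynomials $s_0,s_1,s_2,s_{3,i}\in\mathbb{R}[\bm{x},\bm{d}]$ ($i=1,\ldots,m_d$) and $s_{4,j},\ldots,s_{8,j},s_{9,l,j}\in\mathbb{R}[\bm{x}]$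 ($j,l=1,\ldots,n_X$) for which all these identities hold (feasibility). *)

theory Defs
  imports "HOL-Analysis.Analysis"
begin

section \<open>Polynomials\<close>

text \<open>
  Real polynomials are represented by the functions they induce
  (\<^const>\<open>real_polynomial_function\<close>), which is faithful because the field is infinite; an identity
  between polynomials is then an identity between functions at all points.  Polynomials in
  \<open>(x, d)\<close> are polynomial functions on the product space.
\<close>

definition polys_upto :: "nat \<Rightarrow> (real^'n \<Rightarrow> real) set" where
  "polys_upto k =
     {p. \<exists>c :: ('n \<Rightarrow> nat) \<Rightarrow> real.
           p = (\<lambda>x. \<Sum>\<alpha> | (\<Sum>i\<in>UNIV. \<alpha> i) \<le> k. c \<alpha> * (\<Prod>i\<in>UNIV. (x $ i) ^ \<alpha> i))}"

definition sos_poly :: "('a::real_normed_vector \<Rightarrow> real) \<Rightarrow> bool" where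
  "sos_poly p \<longleftrightarrow>
     (\<exists>(N::nat) q. (\<forall>i<N. real_polynomial_function (q i)) \<and> p = (\<lambda>x. \<Sum>i<N. (q i x)\<^sup>2))"


section \<open>The perturbed system and robust regions of attraction\<close>

definition policies :: "'d set \<Rightarrow> (nat \<Rightarrow> 'd) set" where
  "policies D = {\<pi>. \<forall>k. \<pi> k \<in> D}"

primrec traj :: "('x \<Rightarrow> 'd \<Rightarrow> 'x) \<Rightarrow> (nat \<Rightarrow> 'd) \<Rightarrow> 'x \<Rightarrow> nat \<Rightarrow> 'x" where
  "traj f \<pi> x0 0 = x0"
| "traj f \<pi> x0 (Suc k) = f (traj f \<pi> x0 k) (\<pi> k)"

definition max_robust_roa ::
    "(real^'n \<Rightarrow> real^'m \<Rightarrow> real^'n) \<Rightarrow> (real^'m) set \<Rightarrow> (real^'n) set \<Rightarrow> (real^'n) set" where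
  "max_robust_roa f D X =
     {x0. (\<forall>k. \<forall>\<pi>\<in>policies D. traj f \<pi> x0 k \<in> X) \<and>
          (\<forall>\<pi>\<in>policies D. traj f \<pi> x0 \<longlonglongrightarrow> 0)}"

definition robust_roa ::
    "(real^'n \<Rightarrow> real^'m \<Rightarrow> real^'n) \<Rightarrow> (real^'m) set \<Rightarrow> (real^'n) set \<Rightarrow> (real^'n) set \<Rightarrow> bool" where
  "robust_roa f D X S \<longleftrightarrow> S \<subseteq> max_robust_roa f D X"

definition one_step_set ::
    "('x \<Rightarrow> 'd \<Rightarrow> 'x) \<Rightarrow> 'd set \<Rightarrow> 'x set \<Rightarrow> 'x set" where
  "one_step_set f D X = {x. \<exists>x0\<in>X. \<exists>d\<in>D. x = f x0 d} \<union> X"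


section \<open>Feasibility of the sum-of-squares program\<close>

definition h0 :: "real^'n \<Rightarrow> real" where
  "h0 x = (\<Sum>i\<in>UNIV. (x $ i)\<^sup>2)"

text \<open>
  Feasibility of \<open>u\<close> only: the degree bound on \<open>u\<close> is not included, and the objective plays no role.
  The multipliers \<open>s0\<close>, \<open>s1\<close>, \<open>s2\<close>, \<open>s3 i\<close> are polynomials in \<open>(x, d)\<close>; all others are polynomials
  in \<open>x\<close>.
\<close>

definition sos_feasible ::
    "(real^'n \<Rightarrow> real^'m \<Rightarrow> real^'n) \<Rightarrow> nat \<Rightarrow> (nat \<Rightarrow> real^'m \<Rightarrow> real) \<Rightarrow> nat \<Rightarrow> (nat \<Rightarrow> real^'n \<Rightarrow> real)
      \<Rightarrow> (real^'n \<Rightarrow> real) \<Rightarrow> real \<Rightarrow> (real^'n \<Rightarrow> real) \<Rightarrow> (real^'n \<Rightarrow> real) \<Rightarrow> bool" where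
  "sos_feasible f md hD nX hX g R hinf u \<longleftrightarrow>
     (\<exists>(s0 :: (real^'n) \<times> (real^'m) \<Rightarrow> real) s1 s2 (s3 :: nat \<Rightarrow> (real^'n) \<times> (real^'m) \<Rightarrow> real)
       (s4 :: nat \<Rightarrow> real^'n \<Rightarrow> real) s5 s6 s7 s8 (s9 :: nat \<Rightarrow> nat \<Rightarrow> real^'n \<Rightarrow> real).
        sos_poly s0 \<and> sos_poly s1 \<and> sos_poly s2 \<and> (\<forall>i\<in>{1..md}. sos_poly (s3 i)) \<and>
        (\<forall>j\<in>{1..nX}. sos_poly (s4 j) \<and> sos_poly (s5 j) \<and> sos_poly (s6 j) \<and>
                     sos_poly (s7 j) \<and> sos_poly (s8 j)) \<and>
        (\<forall>l\<in>{1..nX}. \<forall>j\<in>{1..nX}. sos_poly (s9 l j)) \<and>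
        (\<forall>x d. u x - u (f x d) - g x * (1 - u x) =
               s0 (x, d) + s1 (x, d) * (R - h0 x) + s2 (x, d) * (hinf x - 1)
               - (\<Sum>i=1..md. s3 i (x, d) * hD i d)) \<and>
        (\<forall>j\<in>{1..nX}.
           (\<forall>x. u x - 1 = s4 j x + s5 j x * (R - h0 x) + s6 j x * (hX j x - 1)) \<and>
           (\<forall>x. u x - hX j x =
                s7 j x + s8 j x * (R - h0 x) + (\<Sum>l=1..nX. s9 l j x * (1 - hX l x)))))"

end

theory Submission
  imports Defs
begin

text \<open>
  Write \<open>S = {x \<in> B. u x < 1}\<close> and \<open>v = 1 - u\<close>.  Evaluated pointwise, the three families of
  sum-of-squares identities (lemma \<open>sos_feasibleD\<close>) say: \<open>u\<close> is at least \<open>1\<close> on \<open>B\<close> outside \<open>X\<close>,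
  at least the nonnegative \<open>hX j\<close> on \<open>B \<inter> X\<close>, and \<open>v (f x d) \<ge> (1 + g x) * v x\<close> for \<open>d \<in> D\<close> as
  long as \<open>x \<in> B\<close> lies outside \<open>Xinf\<close>.  The first fact places \<open>S\<close> inside \<open>X\<close>, and then the second
  bounds \<open>v\<close> by \<open>1\<close> on \<open>S\<close>.  Since the image of \<open>X\<close> under one step lies in \<open>B\<close>, the third makes every step that starts in \<open>S\<close> outside
  \<open>Xinf\<close> end in \<open>S\<close> again.

  A trajectory that avoids \<open>Xinf\<close> for ever would therefore remain in \<open>S\<close>.  It would also stay away
  from the neighbourhood \<open>interior Xinf\<close> of the origin, so by compactness of \<open>B\<close> the values of \<open>g\<close>
  along it would have a positive lower bound \<open>c\<close>; then \<open>v\<close> would grow at least like \<open>(1 + c) ^ k\<close>,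
  which is impossible for a quantity bounded by \<open>1\<close> (lemma \<open>traj_reaches_target\<close>).  Hence every trajectory from \<open>S\<close> stays
  in \<open>S \<subseteq> X\<close> until it enters \<open>Xinf\<close> after finitely many steps, and from there on the assumption
  that \<open>Xinf\<close> is a robust region of attraction takes over (lemma
  \<open>traj_reaching_max_robust_roa\<close>).
\<close>

lemma sos_poly_nonneg: "sos_poly p \<Longrightarrow> 0 \<le> p x"
  unfolding sos_poly_def by (auto intro!: sum_nonneg)

text \<open>
  Each multiplier is nonnegative, and on the set in question it multiplies a nonnegative
  polynomial; this is the easy half of a Positivstellensatz certificate.
\<close>

lemma sos_feasibleD:
  fixes f :: "real^'n \<Rightarrow> real^'m \<Rightarrow> real^'n"
  assumes feas: "sos_feasible f md hD nX hX g R hinf u" and x: "h0 x \<le> R"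
  shows "hinf x \<ge> 1 \<Longrightarrow> (\<And>i. i \<in> {1..md} \<Longrightarrow> hD i d \<le> 0)
           \<Longrightarrow> g x * (1 - u x) \<le> u x - u (f x d)"
    and "j \<in> {1..nX} \<Longrightarrow> hX j x \<ge> 1 \<Longrightarrow> u x \<ge> 1"
    and "j \<in> {1..nX} \<Longrightarrow> (\<And>l. l \<in> {1..nX} \<Longrightarrow> hX l x \<le> 1) \<Longrightarrow> u x \<ge> hX j x"
proof -
  obtain s0 s1 s2 :: "(real^'n) \<times> (real^'m) \<Rightarrow> real"
    and s3 :: "nat \<Rightarrow> (real^'n) \<times> (real^'m) \<Rightarrow> real"
    and s4 s5 s6 s7 s8 :: "nat \<Rightarrow> real^'n \<Rightarrow> real" and s9 :: "nat \<Rightarrow> nat \<Rightarrow> real^'n \<Rightarrow> real"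
    where sos012: "sos_poly s0" "sos_poly s1" "sos_poly s2"
      and sos3: "\<forall>i\<in>{1..md}. sos_poly (s3 i)"
      and sos4_8: "\<forall>j\<in>{1..nX}. sos_poly (s4 j) \<and> sos_poly (s5 j) \<and> sos_poly (s6 j) \<and>
          sos_poly (s7 j) \<and> sos_poly (s8 j)"
      and sos9: "\<forall>l\<in>{1..nX}. \<forall>j\<in>{1..nX}. sos_poly (s9 l j)"
      and id1: "\<forall>x d. u x - u (f x d) - g x * (1 - u x) =
          s0 (x, d) + s1 (x, d) * (R - h0 x) + s2 (x, d) * (hinf x - 1)
          - (\<Sum>i=1..md. s3 i (x, d) * hD i d)"
      and id23: "\<forall>j\<in>{1..nX}.
          (\<forall>x. u x - 1 = s4 j x + s5 j x * (R - h0 x) + s6 j x * (hX j x - 1)) \<and>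
          (\<forall>x. u x - hX j x =
            s7 j x + s8 j x * (R - h0 x) + (\<Sum>l=1..nX. s9 l j x * (1 - hX l x)))"
    using feas unfolding sos_feasible_def by (elim exE conjE) (rule that; assumption)
  have nonneg:
    "\<And>z. 0 \<le> s0 z" "\<And>z. 0 \<le> s1 z" "\<And>z. 0 \<le> s2 z"
    "\<And>i z. i \<in> {1..md} \<Longrightarrow> 0 \<le> s3 i z"
    "\<And>j z. j \<in> {1..nX} \<Longrightarrow> 0 \<le> s4 j z" "\<And>j z. j \<in> {1..nX} \<Longrightarrow> 0 \<le> s5 j z"
    "\<And>j z. j \<in> {1..nX} \<Longrightarrow> 0 \<le> s6 j z" "\<And>j z. j \<in> {1..nX} \<Longrightarrow> 0 \<le> s7 j z"
    "\<And>j z. j \<in> {1..nX} \<Longrightarrow> 0 \<le> s8 j z"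
    "\<And>l j z. l \<in> {1..nX} \<Longrightarrow> j \<in> {1..nX} \<Longrightarrow> 0 \<le> s9 l j z"
    using sos012 sos3 sos4_8 sos9 by (blast intro: sos_poly_nonneg)+
  show "g x * (1 - u x) \<le> u x - u (f x d)"
    if far: "hinf x \<ge> 1" and dist: "\<And>i. i \<in> {1..md} \<Longrightarrow> hD i d \<le> 0"
  proof -
    have "(\<Sum>i=1..md. s3 i (x, d) * hD i d) \<le> 0"
      by (intro sum_nonpos mult_nonneg_nonpos nonneg dist)
    moreover have "0 \<le> s0 (x, d)" "0 \<le> s1 (x, d) * (R - h0 x)" "0 \<le> s2 (x, d) * (hinf x - 1)"
      using x far by (auto intro!: mult_nonneg_nonneg nonneg)
    ultimately show ?thesis
      using id1[rule_format, of x d] by linarith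
  qed
  show "u x \<ge> 1" if j: "j \<in> {1..nX}" and out: "hX j x \<ge> 1"
  proof -
    have "0 \<le> s4 j x" "0 \<le> s5 j x * (R - h0 x)" "0 \<le> s6 j x * (hX j x - 1)"
      using x out by (auto intro!: mult_nonneg_nonneg nonneg(5-7)[OF j])
    then show ?thesis
      using conjunct1[OF id23[rule_format, OF j], rule_format, of x] by linarith
  qed
  show "u x \<ge> hX j x" if j: "j \<in> {1..nX}" and inX: "\<And>l. l \<in> {1..nX} \<Longrightarrow> hX l x \<le> 1"
  proof -
    have "0 \<le> (\<Sum>l=1..nX. s9 l j x * (1 - hX l x))"
      using inX by (intro sum_nonneg mult_nonneg_nonneg nonneg(10) j) auto
    moreover have "0 \<le> s7 j x" "0 \<le> s8 j x * (R - h0 x)"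
      using x by (auto intro!: mult_nonneg_nonneg nonneg(8,9)[OF j])
    ultimately show ?thesis
      using conjunct2[OF id23[rule_format, OF j], rule_format, of x] by linarith
  qed
qed

lemma compact_h0_sublevel: "compact {x :: real^'n. h0 x \<le> R}"
proof -
  have norm: "sqrt (h0 x) = norm x" for x :: "real^'n"
    by (simp add: h0_def norm_vec_def L2_set_def)
  have "h0 x \<le> R \<longleftrightarrow> x \<in> cball 0 (sqrt R)" for x :: "real^'n"
    unfolding mem_cball_0 norm[symmetric] by (rule real_sqrt_le_iff[symmetric])
  then have "{x :: real^'n. h0 x \<le> R} = cball 0 (sqrt R)"
    by blast
  then show ?thesis
    by (simp only: compact_cball)
qed

lemma traj_add: "traj f \<pi> x (m + k) = traj f (\<lambda>i. \<pi> (m + i)) (traj f \<pi> x m) k"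
  by (induction k) auto

text \<open>
  The tail of a policy is a policy, so whatever happens after the trajectory has reached the
  maximal region is governed by the guarantee for the point at which it arrives.
\<close>

lemma traj_reaching_max_robust_roa:
  assumes \<pi>: "\<pi> \<in> policies D"
    and earlier: "\<And>i. i < m \<Longrightarrow> traj f \<pi> x i \<in> X"
    and reach: "traj f \<pi> x m \<in> max_robust_roa f D X"
  shows "traj f \<pi> x k \<in> X" and "traj f \<pi> x \<longlonglongrightarrow> 0"
proof -
  have tail: "(\<lambda>i. \<pi> (m + i)) \<in> policies D"
    using \<pi> by (simp add: policies_def)
  have inX: "traj f \<pi> x (m + i) \<in> X" for i
    using reach tail unfolding max_robust_roa_def traj_add by blast
  have "traj f (\<lambda>i. \<pi> (m + i)) (traj f \<pi> x m) \<longlonglongrightarrow> 0"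
    using reach tail unfolding max_robust_roa_def by blast
  then have "(\<lambda>i. traj f \<pi> x (i + m)) \<longlonglongrightarrow> 0"
    by (simp only: add.commute[of _ m] traj_add)
  then show "traj f \<pi> x \<longlonglongrightarrow> 0"
    by (rule LIMSEQ_offset)
  show "traj f \<pi> x k \<in> X"
  proof (cases "k < m")
    case True
    then show ?thesis
      by (rule earlier)
  next
    case False
    then show ?thesis
      using inX[of "k - m"] by simp
  qed
qed

lemma geometric_growth_unbounded:
  fixes v :: "nat \<Rightarrow> real"
  assumes c: "0 < c" and pos: "0 < v 0" and growth: "\<And>k. (1 + c) * v k \<le> v (Suc k)"
  shows "\<exists>k. M < v k"
proof -
  have lower: "(1 + c) ^ k * v 0 \<le> v k" for k
  proof (induction k)
    case (Suc k)
    have "(1 + c) ^ Suc k * v 0 = (1 + c) * ((1 + c) ^ k * v 0)"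
      by simp
    also have "\<dots> \<le> (1 + c) * v k"
      using Suc c by (intro mult_left_mono) auto
    finally show ?case
      using growth[of k] by linarith
  qed simp
  obtain k where "M / v 0 < (1 + c) ^ k"
    using real_arch_pow[of "1 + c"] c by auto
  then show ?thesis
    using lower[of k] pos by (auto simp: field_simps intro!: exI[of _ k])
qed

text \<open>
  The system can leave \<open>S\<close> only through \<open>T\<close>, and \<open>S\<close> carries a bounded positive function that
  grows by a factor of at least \<open>1 + g x\<close> at each step outside \<open>T\<close>, so avoiding \<open>T\<close> for ever would
  contradict the bound.  Compactness turns positivity of \<open>g\<close> off the interior of \<open>T\<close> into a uniform
  growth rate.  It is asked of a superset \<open>B\<close> because a strict sublevel set such as
  \<open>{x \<in> B. u x < 1}\<close> need not be closed.
\<close>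

lemma traj_reaches_target:
  fixes f :: "'x::topological_space \<Rightarrow> 'd \<Rightarrow> 'x" and g v :: "'x \<Rightarrow> real"
  assumes B: "compact B" "S \<subseteq> B"
    and g: "continuous_on B g" "\<And>x. x \<in> B - interior T \<Longrightarrow> 0 < g x"
    and step: "\<And>x d. x \<in> S - T \<Longrightarrow> d \<in> D \<Longrightarrow> f x d \<in> S"
    and growth: "\<And>x d. x \<in> S - T \<Longrightarrow> d \<in> D \<Longrightarrow> (1 + g x) * v x \<le> v (f x d)"
    and v: "\<And>x. x \<in> S \<Longrightarrow> 0 < v x" "\<And>x. x \<in> S \<Longrightarrow> v x \<le> M"
    and \<pi>: "\<pi> \<in> policies D" and x: "x \<in> S"
  shows "\<exists>m. traj f \<pi> x m \<in> T \<and> (\<forall>i<m. traj f \<pi> x i \<in> S)"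
proof -
  have \<pi>D: "\<pi> i \<in> D" for i
    using \<pi> by (simp add: policies_def)
  have stays: "traj f \<pi> x k \<in> S" if "\<And>i. i < k \<Longrightarrow> traj f \<pi> x i \<notin> T" for k
    using that
  proof (induction k)
    case 0
    show ?case
      using x by simp
  next
    case (Suc k)
    then show ?case
      using step[of "traj f \<pi> x k" "\<pi> k"] \<pi>D by auto
  qed
  have "\<exists>m. traj f \<pi> x m \<in> T"
  proof (rule ccontr)
    assume "\<nexists>m. traj f \<pi> x m \<in> T"
    then have off: "traj f \<pi> x k \<in> S - T" for k
      using stays[of k] by auto
    have sub: "S - T \<subseteq> B - interior T"
      using B(2) interior_subset[of T] by auto
    then have ne: "B - interior T \<noteq> {}"
      using off[of 0] by auto
    have "compact (B - interior T)"
      using B(1) by (intro compact_diff) auto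
    then obtain y where y: "y \<in> B - interior T" and min: "\<And>z. z \<in> B - interior T \<Longrightarrow> g y \<le> g z"
      using continuous_attains_inf[OF _ ne, of g] continuous_on_subset[OF g(1)] by blast
    have "(1 + g y) * v (traj f \<pi> x k) \<le> v (traj f \<pi> x (Suc k))" for k
    proof -
      let ?z = "traj f \<pi> x k"
      have "(1 + g y) * v ?z \<le> (1 + g ?z) * v ?z"
        using min[of ?z] off[of k] sub v(1)[of ?z] by (intro mult_right_mono) auto
      also have "\<dots> \<le> v (traj f \<pi> x (Suc k))"
        using growth[OF off[of k] \<pi>D[of k]] by simp
      finally show ?thesis .
    qed
    then obtain k where "M < v (traj f \<pi> x k)"
      using geometric_growth_unbounded[of "g y" "\<lambda>k. v (traj f \<pi> x k)" M] g(2)[OF y] v(1)[OF x]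
      by auto
    then show False
      using v(2)[of "traj f \<pi> x k"] off[of k] by auto
  qed
  then obtain m where m: "traj f \<pi> x m \<in> T" "\<And>i. i < m \<Longrightarrow> traj f \<pi> x i \<notin> T"
    using exists_least_iff[of "\<lambda>m. traj f \<pi> x m \<in> T"] by auto
  have "traj f \<pi> x i \<in> S" if "i < m" for i
    using stays[of i] m(2) that by auto
  with m(1) show ?thesis
    by blast
qed

theorem theorem2:
  fixes f :: "real^'n \<Rightarrow> real^'m \<Rightarrow> real^'n"
    and md :: nat and hD :: "nat \<Rightarrow> real^'m \<Rightarrow> real" and D :: "(real^'m) set"
    and nX :: nat and hX :: "nat \<Rightarrow> real^'n \<Rightarrow> real" and X :: "(real^'n) set"
    and g hinf u :: "real^'n \<Rightarrow> real"
    and R :: real and B Xinf :: "(real^'n) set"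
    and k :: nat
  assumes f_poly: "\<And>i. real_polynomial_function (\<lambda>(x, d). f x d $ i)"
    and hD_poly: "\<And>i. i \<in> {1..md} \<Longrightarrow> real_polynomial_function (hD i)"
    and D_eq: "D = {d. \<forall>i\<in>{1..md}. hD i d \<le> 0}"
    and D_compact: "compact D"
    and f_0: "\<And>d. d \<in> D \<Longrightarrow> f 0 d = 0"
    and hX_poly: "\<And>j. j \<in> {1..nX} \<Longrightarrow> real_polynomial_function (hX j)"
    and hX_pos: "\<And>j x. j \<in> {1..nX} \<Longrightarrow> x \<noteq> 0 \<Longrightarrow> hX j x > 0"
    and hX_0: "\<And>j. j \<in> {1..nX} \<Longrightarrow> hX j 0 = 0"
    and X_eq: "X = {x. \<forall>j\<in>{1..nX}. hX j x < 1}"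
    and X_bounded: "bounded X"
    and X_open: "open X"
    and g_poly: "real_polynomial_function g"
    and g_nonneg: "\<And>x. g x \<ge> 0"
    and g_zero_iff: "\<And>x. g x = 0 \<longleftrightarrow> x = 0"
    and B_eq: "B = {x. h0 x \<le> R}"
    and R_pos: "R > 0"
    and one_step_subset: "one_step_set f D X \<subseteq> B"
    and hinf_poly: "real_polynomial_function hinf"
    and Xinf_eq: "Xinf = {x. hinf x < 1}"
    and Xinf_roa: "robust_roa f D X Xinf"
    and Xinf_interior: "0 \<in> interior Xinf"
    and u_deg: "u \<in> polys_upto k"
    and u_sol: "sos_feasible f md hD nX hX g R hinf u"
  shows "robust_roa f D X {x \<in> B. u x < 1}"
proof -
  define S where "S = {x \<in> B. u x < 1}"
  note cert = sos_feasibleD[OF u_sol]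
  \<comment> \<open>Without constraints \<open>X\<close> would be the whole space, which is unbounded.\<close>
  have one: "1 \<in> {1..nX}"
  proof (rule ccontr)
    assume "1 \<notin> {1..nX}"
    then have "X = UNIV"
      by (auto simp: X_eq)
    then show False
      using X_bounded not_bounded_UNIV[where 'a = "real^'n"] by simp
  qed
  have u_nonneg: "0 \<le> u x" if "x \<in> B" "x \<in> X" for x
  proof -
    have "hX 1 x \<le> u x"
      using that one by (intro cert(3)) (auto simp: B_eq X_eq less_imp_le)
    moreover have "0 \<le> hX 1 x"
      using hX_pos[of 1 x] hX_0[of 1] one by (cases "x = 0") auto
    ultimately show ?thesis
      by simp
  qed
  have S_X: "S \<subseteq> X"
    using cert(2) by (fastforce simp: S_def B_eq X_eq not_less)
  have S_B: "S \<subseteq> B"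
    by (auto simp: S_def)
  have growth: "(1 + g x) * (1 - u x) \<le> 1 - u (f x d)" if "x \<in> S - Xinf" "d \<in> D" for x d
    using cert(1)[of x d] that by (auto simp: S_def B_eq Xinf_eq D_eq algebra_simps)
  have step: "f x d \<in> S" if x: "x \<in> S - Xinf" and d: "d \<in> D" for x d
  proof -
    have "f x d \<in> B"
      using x d S_X one_step_subset by (auto simp: one_step_set_def)
    moreover have "0 < (1 + g x) * (1 - u x)"
      using x g_nonneg[of x] by (intro mult_pos_pos) (auto simp: S_def)
    ultimately show ?thesis
      using growth[OF x d] by (simp add: S_def)
  qed
  have v_pos: "0 < 1 - u x" if "x \<in> S" for x
    using that by (simp add: S_def)
  have v_le: "1 - u x \<le> 1" if "x \<in> S" for x
    using u_nonneg[of x] that S_X S_B by auto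
  have g_pos: "0 < g x" if "x \<in> B - interior Xinf" for x
    using that Xinf_interior g_nonneg[of x] g_zero_iff[of x] by fastforce
  have g_cont: "continuous_on B g"
    using g_poly by (intro continuous_at_imp_continuous_on ballI continuous_real_polymonial_function)
  have B_compact: "compact B"
    unfolding B_eq by (rule compact_h0_sublevel)
  have "traj f \<pi> x k \<in> X \<and> traj f \<pi> x \<longlonglongrightarrow> 0" if x: "x \<in> S" and \<pi>: "\<pi> \<in> policies D" for x \<pi> k
  proof -
    have "\<exists>m. traj f \<pi> x m \<in> Xinf \<and> (\<forall>i<m. traj f \<pi> x i \<in> S)"
      by (rule traj_reaches_target[where v = "\<lambda>z. 1 - u z" and M = 1,
            OF B_compact S_B g_cont g_pos step growth v_pos v_le \<pi> x])
    then obtain m where m: "traj f \<pi> x m \<in> Xinf" "\<And>i. i < m \<Longrightarrow> traj f \<pi> x i \<in> S"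
      by blast
    have "traj f \<pi> x m \<in> max_robust_roa f D X"
      using m(1) Xinf_roa by (auto simp: robust_roa_def)
    moreover have "traj f \<pi> x i \<in> X" if "i < m" for i
      using m(2)[OF that] S_X by auto
    ultimately show ?thesis
      using traj_reaching_max_robust_roa[OF \<pi>, of m f x X] by blast
  qed
  then show ?thesis
    unfolding robust_roa_def max_robust_roa_def S_def[symmetric] by blast
qed

end
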